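(* There exist a matrix $A \in \mathbb{R}^{2 \times 2}$ and a matrix $B \in \mathbb{R}^{2 \times 5}$ such that: (1) $A$ is strictly stable; (2) $\mathcal{E}_{\rm ave}(A, B(S), +\infty)$ is finite for every nonempty $S \subset \{1,\ldots,5\}$; (3) the function $S \mapsto \mathcal{E}_{\rm ave}(A, B(S), +\infty)$, defined on subsets $S$ of $\{1,\ldots,5\}$, is not supermodular.
   Context: A square real matrix is called strictly stable if all of its eigenvalues have negative real parts. For $B \in \mathbb{R}^{n \times m}$ and $S \subset \{1,\ldots,m\}$, $B(S) \in \mathbb{R}^{n \times |S|}$ denotes the matrix composed of the columns of $B$ with indices in $S$. For a strictly stable $A \in \mathbb{R}^{n \times n}$ and $B \in \mathbb{R}^{n \times k}$, the (infinite-horizon) controllability Gramian is $W(A,B,+\infty) = \int_0^{+\infty} e^{At} B B' e^{A't}\, dt$, where $M'$ denotes the transpose of $M$ (if $k=0$ the Gramian is the zero matrix). The average control energy is $$\mathcal{E}_{\rm ave}(A,B,+\infty) = \frac{1}{n}\,\mathrm{tr}\left[ W(A,B,+\infty)^{-1} \right]$$ if $W(A,B,+\infty)$ is invertible, and $\mathcal{E}_{\rm ave}(A,B,+\infty) = +\infty$ otherwise. (It represents the expected minimal input energy $\int \|u(t)\|_2^2\,dt$ needed to steer $\dot{x} = Ax+Bu$ from the origin to a uniformly random point of the unit sphere.) A function $f : 2^{\{1,\ldots,m\}} \to \mathbb{R} \cup \{+\infty\}$ is called supermodular if $$f(S_1) - f(S_1 \cup \{a\}) \geq f(S_2) - f(S_2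 \cup \{a\})$$ for all $S_1 \subset S_2 \subset \{1,\ldots,m\}$ and $a \in \{1,\ldots,m\} \setminus S_2$ such that all four terms in this inequality are finite. *)

theory Defs
  imports
    "HOL-Analysis.Henstock_Kurzweil_Integration"
    "Jordan_Normal_Form.Char_Poly"
    "Jordan_Normal_Form.DL_Submatrix"
    "Jordan_Normal_Form.Gauss_Jordan_Elimination"
begin

definition strictly_stable :: "real mat \<Rightarrow> bool" where
  "strictly_stable A \<longleftrightarrow>
     square_mat A \<and> (\<forall>z. eigenvalue (map_mat complex_of_real A) z \<longrightarrow> Re z < 0)"

text \<open>Columns are numbered from \<open>0\<close>, so the index set \<open>{1,\<dots>,m}\<close> becomes \<open>{..<m}\<close>.\<close>

definition select_cols :: "'a mat \<Rightarrow> nat set \<Rightarrow> 'a mat" where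
  "select_cols B S = submatrix B UNIV S"

definition mat_trace :: "'a::comm_monoid_add mat \<Rightarrow> 'a" where
  "mat_trace M = (\<Sum>i<dim_row M. M $$ (i, i))"

text \<open>The type of matrices of all sizes carries no topology, so the exponential series and the
  integral of a matrix-valued function are taken entrywise.\<close>

definition mat_exp :: "real mat \<Rightarrow> real mat" where
  "mat_exp M = mat (dim_row M) (dim_row M) (\<lambda>(i, j). \<Sum>k. (M ^\<^sub>m k) $$ (i, j) / fact k)"

definition gramian_inf :: "real mat \<Rightarrow> real mat \<Rightarrow> real mat" where
  "gramian_inf A B = mat (dim_row A) (dim_row A) (\<lambda>(i, j).
     integral {0..} (\<lambda>t.
       (mat_exp (t \<cdot>\<^sub>m A) * B * transpose_mat B * mat_exp (t \<cdot>\<^sub>m transpose_mat A)) $$ (i, j)))"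

definition avg_energy_inf :: "real mat \<Rightarrow> real mat \<Rightarrow> ereal" where
  "avg_energy_inf A B =
     (let W = gramian_inf A B in
      if invertible_mat W
      then ereal (1 / real (dim_row A) * mat_trace (the (mat_inverse W)))
      else \<infinity>)"

definition supermodular_on :: "'a set \<Rightarrow> ('a set \<Rightarrow> ereal) \<Rightarrow> bool" where
  "supermodular_on V f \<longleftrightarrow>
     (\<forall>S1 S2 a. S1 \<subseteq> S2 \<and> S2 \<subseteq> V \<and> a \<in> V - S2 \<and>
        \<bar>f S1\<bar> \<noteq> \<infinity> \<and> \<bar>f (S1 \<union> {a})\<bar> \<noteq> \<infinity> \<and> \<bar>f S2\<bar> \<noteq> \<infinity> \<and> \<bar>f (S2 \<union> {a})\<bar> \<noteq> \<infinity> \<longrightarrow>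
        f S1 - f (S1 \<union> {a}) \<ge> f S2 - f (S2 \<union> {a}))"

end

theory Submission
  imports Defs "HOL-Analysis.Convex"
begin

text \<open>
  Diagonal dynamics \<open>A = diag (- l\<^sub>0, - l\<^sub>1)\<close> with positive decay rates already suffice. For them the
  Gramian is explicit: its entry \<open>(i, j)\<close> is that of \<open>B B'\<close> divided by \<open>l\<^sub>i + l\<^sub>j\<close>
  (\<open>gramian_inf_mat_diag\<close>). The inverse of an invertible \<open>2 \<times> 2\<close> matrix \<open>W\<close> has trace
  \<open>tr W / det W\<close>, so with \<open>p\<close>, \<open>q\<close>, \<open>r\<close> the sums over \<open>s \<in> S\<close> of \<open>x\<^sub>s\<^sup>2\<close>, \<open>y\<^sub>s\<^sup>2\<close>, \<open>x\<^sub>s y\<^sub>s\<close>, where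
  \<open>(x\<^sub>s, y\<^sub>s)\<close> is column \<open>s\<close> of \<open>B\<close>, the energy is a rational function of \<open>p\<close>, \<open>q\<close>, \<open>r\<close>
  (\<open>avg_energy_inf_planar_diag\<close>).

  Finiteness is controllability. By Cauchy--Schwarz \<open>r\<^sup>2 \<le> p q\<close>, and \<open>4 l\<^sub>0 l\<^sub>1 < (l\<^sub>0 + l\<^sub>1)\<^sup>2\<close> for
  distinct rates, so \<open>det W > 0\<close> as soon as \<open>p\<close> and \<open>q\<close> are positive. Hence if no entry of \<open>B\<close>
  vanishes, every nonempty set of columns has finite energy.

  Supermodularity fails because \<open>W \<mapsto> W\<^sup>-\<^sup>2\<close> does not reverse the positive semidefinite order. To
  first order, adding a Gramian \<open>C\<close> to \<open>W\<close> lowers \<open>tr W\<^sup>-\<^sup>1\<close> by \<open>tr (W\<^sup>-\<^sup>2 C)\<close>. This gain is small when \<open>C\<close>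
  acts mainly along the dominant eigenvector of \<open>W\<close>, the direction that is cheap already. A further
  column can rotate the dominant eigenvector away from \<open>C\<close> and thereby make \<open>C\<close> more valuable than it
  was before. For the rates \<open>1, 2\<close> this happens with \<open>S\<^sub>1 = {(1, -1), (2, 1)}\<close>, the further column
  \<open>(2, -1)\<close> and a second copy of \<open>(2, 1)\<close> as the added one: the gain without the further column is
  \<open>54/41 - 21/19\<close>, about \<open>0.212\<close>, and the gain with it is \<open>189/235 - 27/46\<close>, about \<open>0.217\<close>. The
  remaining column of \<open>B\<close> only brings the number of columns to five.
\<close>

section \<open>Diagonal systems\<close>

lemma mat_diag_pow: "mat_diag n f ^\<^sub>m k = mat_diag n (\<lambda>i. f i ^ k)"
proof (induction k)
  case 0
  then show ?case by (simp add: mat_diag_def)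
next
  case (Suc k)
  then show ?case by (simp add: power_commutes)
qed

lemma smult_mat_diag: "c \<cdot>\<^sub>m mat_diag n f = mat_diag n (\<lambda>i. c * f i)"
  for c :: "'a::mult_zero"
  by (rule eq_matI) (auto simp: mat_diag_def)

lemma transpose_mat_diag: "transpose_mat (mat_diag n f) = mat_diag n f"
  by (rule eq_matI) (auto simp: mat_diag_def)

lemma mat_exp_mat_diag: "mat_exp (mat_diag n f) = mat_diag n (\<lambda>i. exp (f i))"
proof (rule eq_matI)
  fix i j
  assume "i < dim_row (mat_diag n (\<lambda>i. exp (f i)))" "j < dim_col (mat_diag n (\<lambda>i. exp (f i)))"
  then have ij: "i < n" "j < n" by (auto simp: mat_diag_def)
  have "(\<Sum>k. (mat_diag n f ^\<^sub>m k) $$ (i, j) / fact k) = (if i = j then exp (f j) else 0)"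
    using ij unfolding mat_diag_pow
    by (simp add: mat_diag_def exp_def divide_inverse mult.commute)
  then show "mat_exp (mat_diag n f) $$ (i, j) = mat_diag n (\<lambda>i. exp (f i)) $$ (i, j)"
    using ij by (simp add: mat_exp_def mat_diag_def)
qed (auto simp: mat_exp_def mat_diag_def)

lemma strictly_stable_mat_diag:
  assumes "\<And>i. i < n \<Longrightarrow> f i < 0"
  shows "strictly_stable (mat_diag n f)"
  unfolding strictly_stable_def
proof (intro conjI allI impI)
  show "square_mat (mat_diag n f)" by (simp add: mat_diag_def)
  fix z
  let ?A = "map_mat complex_of_real (mat_diag n f)"
  assume "eigenvalue ?A z"
  then obtain v where v: "v \<in> carrier_vec n" "v \<noteq> 0\<^sub>v n" "?A *\<^sub>v v = z \<cdot>\<^sub>v v"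
    by (auto simp: eigenvalue_def eigenvector_def mat_diag_def)
  then obtain i where i: "i < n" "v $ i \<noteq> 0"
    by (metis carrier_vecD eq_vecI index_zero_vec)
  have "(?A *\<^sub>v v) $ i = (\<Sum>j<n. complex_of_real (if i = j then f j else 0) * v $ j)"
    using v(1) i(1) by (simp add: mat_diag_def scalar_prod_def atLeast0LessThan)
  also have "\<dots> = (\<Sum>j<n. if i = j then complex_of_real (f j) * v $ j else 0)"
    by (intro sum.cong) auto
  also have "\<dots> = complex_of_real (f i) * v $ i"
    using i(1) by simp
  finally have "complex_of_real (f i) * v $ i = z * v $ i"
    using v i(1) by (simp only: index_smult_vec carrier_vecD)
  with i assms show "Re z < 0" by auto
qed

text \<open>Both exponentials are diagonal, so the integrand at \<open>(i, j)\<close> is the constant \<open>(B B')\<^sub>i\<^sub>j\<close> times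
  a single decaying exponential with rate \<open>l\<^sub>i + l\<^sub>j\<close>.\<close>

lemma gramian_inf_mat_diag:
  fixes l :: "nat \<Rightarrow> real"
  assumes l: "\<And>i. i < n \<Longrightarrow> l i > 0" and B: "B \<in> carrier_mat n m"
  shows "gramian_inf (mat_diag n (\<lambda>i. - l i)) B =
    mat n n (\<lambda>(i, j). (\<Sum>k<m. B $$ (i, k) * B $$ (j, k)) / (l i + l j))"
proof (rule eq_matI)
  let ?A = "mat_diag n (\<lambda>i. - l i)"
  let ?G = "mat n n (\<lambda>(i, j). (\<Sum>k<m. B $$ (i, k) * B $$ (j, k)) / (l i + l j))"
  fix i j
  assume "i < dim_row ?G" "j < dim_col ?G"
  then have ij: "i < n" "j < n" by auto
  define c where "c = (\<Sum>k<m. B $$ (i, k) * B $$ (j, k))"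
  have integrand: "(mat_exp (t \<cdot>\<^sub>m ?A) * B * transpose_mat B * mat_exp (t \<cdot>\<^sub>m transpose_mat ?A)) $$ (i, j)
      = c * exp (- (l i + l j) * t)" for t
  proof -
    let ?E = "mat_diag n (\<lambda>i. exp (t * - l i))"
    have BB: "B * transpose_mat B \<in> carrier_mat n n" using B by auto
    have "?E * B * transpose_mat B * ?E = ?E * (B * transpose_mat B) * ?E"
      using B by (subst assoc_mult_mat[of _ n n _ m _ n]) auto
    also have "\<dots> = mat n n (\<lambda>(i, j). exp (t * - l i) * (B * transpose_mat B) $$ (i, j)) * ?E"
      by (simp only: mat_diag_mult_left[OF BB])
    also have "\<dots> $$ (i, j) = exp (t * - l i) * (B * transpose_mat B) $$ (i, j) * exp (t * - l j)"
      using ij by (subst mat_diag_mult_right[of _ n n]) auto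
    also have "(B * transpose_mat B) $$ (i, j) = c"
      using ij B by (simp add: c_def scalar_prod_def atLeast0LessThan)
    finally show ?thesis
      by (simp add: smult_mat_diag transpose_mat_diag mat_exp_mat_diag ring_distribs
          mult.commute exp_add[symmetric] exp_diff exp_minus field_simps)
  qed
  have "((\<lambda>t. c * exp (- (l i + l j) * t)) has_integral c * (exp (- (l i + l j) * 0) / (l i + l j))) {0..}"
    using l ij by (intro has_integral_mult_right has_integral_exp_minus_to_infinity add_pos_pos) auto
  then have "integral {0..} (\<lambda>t. c * exp (- (l i + l j) * t)) = c / (l i + l j)"
    by (subst integral_unique) simp_all
  moreover have "dim_row ?A = n" by (simp add: mat_diag_def)
  then have "gramian_inf ?A B $$ (i, j) = integral {0..}
      (\<lambda>t. (mat_exp (t \<cdot>\<^sub>m ?A) * B * transpose_mat B * mat_exp (t \<cdot>\<^sub>m transpose_mat ?A)) $$ (i, j))"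
    using ij by (simp add: gramian_inf_def)
  ultimately have "gramian_inf ?A B $$ (i, j) = c / (l i + l j)"
    unfolding integrand by (rule trans[rotated])
  then show "gramian_inf ?A B $$ (i, j) = ?G $$ (i, j)"
    using ij by (simp add: c_def)
qed (auto simp: gramian_inf_def mat_diag_def)

section \<open>Sums over selected columns\<close>

lemma bij_betw_pick:
  assumes "finite S"
  shows "bij_betw (pick S) {..<card S} S"
proof -
  have inj: "inj_on (pick S) {..<card S}"
    by (rule linorder_inj_onI) (use pick_mono_le in fastforce)+
  moreover have "pick S ` {..<card S} \<subseteq> S"
    using pick_in_set_le by auto
  ultimately show ?thesis
    using assms by (simp add: bij_betw_def card_image card_subset_eq)
qed

lemma select_cols_carrier:
  assumes "B \<in> carrier_mat n m" "S \<subseteq> {..<m}"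
  shows "select_cols B S \<in> carrier_mat n (card S)"
proof -
  have "{j. j < m \<and> j \<in> S} = S" using assms by auto
  with assms show ?thesis by (auto simp: select_cols_def dim_submatrix)
qed

text \<open>The Gramian sees the selected columns only through \<open>B(S) B(S)'\<close>. Since \<open>pick S\<close> enumerates \<open>S\<close>
  without repetition, that product is a sum indexed by \<open>S\<close> itself, and the renumbering of the columns
  disappears from all later computations.\<close>

lemma sum_select_cols:
  assumes B: "B \<in> carrier_mat n m" and S: "S \<subseteq> {..<m}" and ij: "i < n" "j < n"
  shows "(\<Sum>k<card S. select_cols B S $$ (i, k) * select_cols B S $$ (j, k))
    = (\<Sum>s\<in>S. B $$ (i, s) * B $$ (j, s))"
proof -
  have S': "{j. j < m \<and> j \<in> S} = S" using S by auto
  have "(\<Sum>k<card S. select_cols B S $$ (i, k) * select_cols B S $$ (j, k))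
      = (\<Sum>k<card S. B $$ (i, pick S k) * B $$ (j, pick S k))"
    using B S' ij by (intro sum.cong) (auto simp: select_cols_def submatrix_index pick_UNIV)
  also have "\<dots> = (\<Sum>s\<in>S. B $$ (i, s) * B $$ (j, s))"
    using bij_betw_pick[OF finite_subset[OF S finite_lessThan]] by (rule sum.reindex_bij_betw)
  finally show ?thesis .
qed

section \<open>Average energy of a planar diagonal system\<close>

lemma mat_inverse_eqI:
  fixes W :: "'a::field mat"
  assumes W: "W \<in> carrier_mat n n" and C: "C \<in> carrier_mat n n"
    and WC: "W * C = 1\<^sub>m n" and CW: "C * W = 1\<^sub>m n"
  shows "mat_inverse W = Some C"
proof (cases "mat_inverse W")
  case None
  then show ?thesis
    using mat_inverse(1)[OF W None, where b = "()"] assms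
    by (auto simp: Units_def ring_mat_def)
next
  case (Some D)
  then have D: "D * W = 1\<^sub>m n" "D \<in> carrier_mat n n"
    using mat_inverse(2)[OF W] by auto
  have "D = D * (W * C)" using D WC by simp
  also have "\<dots> = (D * W) * C" by (rule assoc_mult_mat[OF D(2) W C, symmetric])
  also have "\<dots> = C" using D C by simp
  finally show ?thesis using Some by simp
qed

lemma planar_inverse_trace:
  fixes a b c d :: real
  assumes W: "W = mat 2 2 (\<lambda>(i, j). if i = 0 then (if j = 0 then a else b) else (if j = 0 then c else d))"
    and det: "a * d - b * c \<noteq> 0"
  shows "invertible_mat W" "mat_trace (the (mat_inverse W)) = (a + d) / (a * d - b * c)"
proof -
  define D where "D = a * d - b * c"
  define C where "C = mat 2 2 (\<lambda>(i, j).
    if i = 0 then (if j = 0 then d / D else - b / D) else (if j = 0 then - c / D else a / D))"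
  have carr: "W \<in> carrier_mat 2 2" "C \<in> carrier_mat 2 2" by (auto simp: W C_def)
  have D: "D \<noteq> 0" using det by (simp add: D_def)
  have WC: "W * C = 1\<^sub>m 2" "C * W = 1\<^sub>m 2"
    using D by (auto intro!: eq_matI
      simp: W C_def scalar_prod_def less_2_cases_iff numeral_2_eq_2 field_simps) (auto simp: D_def)
  show "invertible_mat W"
    unfolding invertible_mat_def inverts_mat_def using WC carr by auto
  show "mat_trace (the (mat_inverse W)) = (a + d) / (a * d - b * c)"
    by (simp add: mat_inverse_eqI[OF carr WC] mat_trace_def)
      (simp add: C_def D_def numeral_2_eq_2 add_divide_distrib)
qed

lemma avg_energy_inf_planar_diag:
  fixes l :: "nat \<Rightarrow> real" and S :: "nat set"
  assumes l: "\<And>i. i < 2 \<Longrightarrow> l i > 0" and B: "B \<in> carrier_mat 2 m" and S: "S \<subseteq> {..<m}"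
  defines "p \<equiv> \<Sum>s\<in>S. B $$ (0, s) ^ 2"
    and "q \<equiv> \<Sum>s\<in>S. B $$ (1, s) ^ 2"
    and "r \<equiv> \<Sum>s\<in>S. B $$ (0, s) * B $$ (1, s)"
  defines "D \<equiv> p * q / (4 * l 0 * l 1) - r ^ 2 / (l 0 + l 1) ^ 2"
  assumes D: "D \<noteq> 0"
  shows "avg_energy_inf (mat_diag 2 (\<lambda>i. - l i)) (select_cols B S)
    = ereal ((p / (2 * l 0) + q / (2 * l 1)) / (2 * D))"
proof -
  let ?A = "mat_diag 2 (\<lambda>i. - l i)"
  define W where "W = gramian_inf ?A (select_cols B S)"
  have "W = mat 2 2 (\<lambda>(i, j). (\<Sum>s\<in>S. B $$ (i, s) * B $$ (j, s)) / (l i + l j))"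
    unfolding W_def using l
    by (subst gramian_inf_mat_diag[OF _ select_cols_carrier[OF B S]])
      (auto simp: sum_select_cols[OF B S] intro!: eq_matI)
  also have "\<dots> = mat 2 2 (\<lambda>(i, j). if i = 0
      then (if j = 0 then p / (2 * l 0) else r / (l 0 + l 1))
      else (if j = 0 then r / (l 0 + l 1) else q / (2 * l 1)))"
    by (rule eq_matI)
      (auto simp: less_2_cases_iff p_def q_def r_def power2_eq_square mult.commute add.commute)
  finally have W: "W = \<dots>" .
  have det: "p / (2 * l 0) * (q / (2 * l 1)) - r / (l 0 + l 1) * (r / (l 0 + l 1)) = D"
    by (simp add: D_def power2_eq_square)
  have "dim_row ?A = 2" by (simp add: mat_diag_def)
  then show ?thesis
    using planar_inverse_trace[OF W] D unfolding det
    by (simp add: avg_energy_inf_def W_def[symmetric])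
qed

text \<open>A column without zero entries excites both modes, and distinct decay rates keep the responses of
  the two modes linearly independent. In the determinant this is strictness in \<open>4 a b < (a + b)\<^sup>2\<close>,
  which the Cauchy--Schwarz inequality for the columns alone would not give.\<close>

lemma planar_gramian_det_pos:
  fixes x y :: "'a \<Rightarrow> real" and a b :: real
  assumes S: "finite S" "S \<noteq> {}" and xy: "\<And>s. s \<in> S \<Longrightarrow> x s \<noteq> 0 \<and> y s \<noteq> 0"
    and ab: "a > 0" "b > 0" "a \<noteq> b"
  shows "(\<Sum>s\<in>S. x s ^ 2) * (\<Sum>s\<in>S. y s ^ 2) / (4 * a * b) - (\<Sum>s\<in>S. x s * y s) ^ 2 / (a + b) ^ 2 > 0"
proof -
  define P where "P = (\<Sum>s\<in>S. x s ^ 2) * (\<Sum>s\<in>S. y s ^ 2)"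
  have "P > 0"
    unfolding P_def using S xy by (intro mult_pos_pos sum_pos) auto
  have "(\<Sum>s\<in>S. x s * y s) ^ 2 / (a + b) ^ 2 \<le> P / (a + b) ^ 2"
    unfolding P_def by (intro divide_right_mono Cauchy_Schwarz_ineq_sum) auto
  also have "\<dots> < P / (4 * a * b)"
  proof (rule divide_strict_left_mono)
    have "(a - b) ^ 2 > 0" using ab by simp
    then show "4 * a * b < (a + b) ^ 2" by (simp add: power2_eq_square algebra_simps)
    show "0 < (a + b) ^ 2 * (4 * a * b)" using ab by simp
  qed fact
  finally show ?thesis by (simp add: P_def)
qed

section \<open>The counterexample\<close>

theorem theorem1:
  shows "\<exists>(A :: real mat) \<in> carrier_mat 2 2. \<exists>(B :: real mat) \<in> carrier_mat 2 5.
    strictly_stable A \<and>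
    (\<forall>S. S \<subseteq> {..<5} \<and> S \<noteq> {} \<longrightarrow> \<bar>avg_energy_inf A (select_cols B S)\<bar> \<noteq> \<infinity>) \<and>
    \<not> supermodular_on {..<5} (\<lambda>S. avg_energy_inf A (select_cols B S))"
proof -
  define l :: "nat \<Rightarrow> real" where "l i = real i + 1" for i
  define A where "A = mat_diag 2 (\<lambda>i. - l i)"
  define x :: "nat \<Rightarrow> real" where "x s = [1, 2, 2, 2, 1] ! s" for s
  define y :: "nat \<Rightarrow> real" where "y s = [-1, 1, -1, 1, 1] ! s" for s
  define B where "B = mat 2 5 (\<lambda>(i, s). if i = 0 then x s else y s)"
  define f where "f S = avg_energy_inf A (select_cols B S)" for S
  have B: "B \<in> carrier_mat 2 5" by (simp add: B_def)
  have xy: "x s \<noteq> 0 \<and> y s \<noteq> 0" if "s < 5" for s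
    using that by (auto simp: x_def y_def numeral_eq_Suc less_Suc_eq)
  have f: "f S = ereal (((\<Sum>s\<in>S. x s ^ 2) / 2 + (\<Sum>s\<in>S. y s ^ 2) / 4) /
      (2 * ((\<Sum>s\<in>S. x s ^ 2) * (\<Sum>s\<in>S. y s ^ 2) / 8 - (\<Sum>s\<in>S. x s * y s) ^ 2 / 9)))"
    if S: "S \<subseteq> {..<5}" "S \<noteq> {}" for S
  proof -
    have entries: "B $$ (0, s) = x s" "B $$ (1, s) = y s" if "s \<in> S" for s
      using that S by (auto simp: B_def)
    have sums: "(\<Sum>s\<in>S. B $$ (0, s) ^ 2) = (\<Sum>s\<in>S. x s ^ 2)"
      "(\<Sum>s\<in>S. B $$ (1, s) ^ 2) = (\<Sum>s\<in>S. y s ^ 2)"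
      "(\<Sum>s\<in>S. B $$ (0, s) * B $$ (1, s)) = (\<Sum>s\<in>S. x s * y s)"
      using entries by (auto intro: sum.cong)
    have l: "l i > 0" for i by (simp add: l_def)
    have "(\<Sum>s\<in>S. x s ^ 2) * (\<Sum>s\<in>S. y s ^ 2) / (4 * l 0 * l 1)
        - (\<Sum>s\<in>S. x s * y s) ^ 2 / (l 0 + l 1) ^ 2 > 0"
      using S xy l by (intro planar_gramian_det_pos) (auto intro: finite_subset simp: l_def)
    from avg_energy_inf_planar_diag[OF l B S(1), unfolded sums, OF less_imp_neq[OF this, symmetric]]
    show ?thesis unfolding f_def A_def by (simp add: l_def)
  qed
  \<comment> \<open>Column 3 repeats column 1. It gains more on top of columns 0, 1, 2 than on top of 0, 1.\<close>
  have "\<not> supermodular_on {..<5} f"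
  proof
    assume "supermodular_on {..<5} f"
    moreover have vals: "f {0, 1} = ereal (54 / 41)" "f ({0, 1} \<union> {3}) = ereal (21 / 19)"
      "f {0, 1, 2} = ereal (189 / 235)" "f ({0, 1, 2} \<union> {3}) = ereal (27 / 46)"
      by (subst f; simp add: x_def y_def)+
    ultimately have "f {0, 1} - f ({0, 1} \<union> {3}) \<ge> f {0, 1, 2} - f ({0, 1, 2} \<union> {3})"
      unfolding supermodular_on_def
      by (elim allE[where x = "{0, 1}"] allE[where x = "{0, 1, 2}"] allE[where x = 3]) simp
    then show False unfolding vals by simp
  qed
  moreover have "strictly_stable A"
    unfolding A_def by (rule strictly_stable_mat_diag) (simp add: l_def)
  moreover have "\<bar>f S\<bar> \<noteq> \<infinity>" if "S \<subseteq> {..<5} \<and> S \<noteq> {}" for S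
    using that by (simp add: f)
  ultimately show ?thesis
    using B by (intro bexI[of _ A] bexI[of _ B]) (auto simp: A_def f_def[abs_def])
qed

end
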